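(* Let $M$ be the monoid defined by the monoid presentation $\langle A\mid R\rangle$, and let $\rho$ be a right congruence on $M$ with word graph $\Gamma=(V,E)$. Then $\rho$ is a 2-sided congruence if and only if $\Gamma$ is compatible with $$\{(w_\alpha a,\,w_\beta) : (\alpha,a,\beta)\in E\},$$ where $w_\alpha\in A^*$ is the short-lex minimum word labelling any $(0,\alpha)$-path in $\Gamma$.
   Context: Functions are written to the right of their arguments. $A=\{a_0<\dots<a_{k-1}\}$ is a finite linearly ordered alphabet, $A^*$ is the free monoid on $A$ with identity the empty word $\varepsilon$, and $R\subseteq A^*\times A^*$. $R^{\#}$ is the least 2-sided congruence on $A^*$ containing $R$; the monoid defined by $\langle A\mid R\rangle$ is $M\cong A^*/R^{\#}$, and $\theta:A^*\to M$ is the natural surjective homomorphism with $\ker(\theta)=R^{\#}$. For $T\subseteq A^*\times A^*$ write $(T)\theta=\{((u)\theta,(v)\theta): (u,v)\in T\}$. A right congruence on $M$ is an equivalence relation $\rho$ with $(xs,ys)\in\rho$ for all $(x,y)\in\rho$, $s\in M$; left congruences are dual; a 2-sided congruence is both. A word graph over $A$ is a digraph $\Gamma=(V,E)$ with $E\subseteq V\times A\times V$; an edge $(\alpha,a,\beta)$ has source $\alpha$, label $a$, target $\beta$. It is complete (respectively deterministic) if for every node $\alpha$ and every $a\in A$ there is at least (respectively at most) one edge with source $\alpha$ and label $a$. A path is labelled by the product of the labels of its edges; the empty path at any node is labelled by $\varepsilon$. Write $\alpha\cdot u=\beta$ if $u\in A^*$ labels a path from $\alpha$ to $\beta$ (an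 $(\alpha,\beta)$-path), and $\alpha\cdot u=\bot$ (undefined) if $u$ labels no path with source $\alpha$. The path relation is $(\alpha)\pi_\Gamma=\{(u,v)\in A^*\times A^*:\alpha\cdot u\neq\bot,\ \alpha\cdot u=\alpha\cdot v\}$. For $T\subseteq A^*\times A^*$, $\Gamma$ is compatible with $T$ if for all $(u,v)\in T$ and $\alpha\in V$, $\alpha\cdot u=\alpha\cdot v$ whenever $\alpha\cdot u\ne\bot$ and $\alpha\cdot v\neq\bot$. The short-lex order on $A^*$: $u<v$ if $|u|<|v|$, or $|u|=|v|$ and $u$ is strictly lexicographically smaller than $v$. A complete word graph $\Gamma=(V,E)$ is standard if $V=\{0,1,\ldots,|V|-1\}$ (meaning $\{0,1,2,\ldots\}$ if $V$ is infinite), $\Gamma$ is deterministic, every node is reachable from $0$, and for all $\alpha,\beta\in V$: $\alpha<\beta$ if and only if $w_\alpha<w_\beta$, with $w_\alpha$ the short-lex least word labelling a $(0,\alpha)$-path. The word graph of a right congruence $\rho$ on $M$ is the unique standard complete word graph $\Gamma$ over $A$ compatible with $R$ such that $\rho=((0)\pi_\Gamma)\theta$. *)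

theory Defs
  imports "HOL-Algebra.Group"
begin

section \<open>Congruences on a monoid\<close>

definition right_congruence :: "('m, 'b) monoid_scheme \<Rightarrow> ('m \<times> 'm) set \<Rightarrow> bool" where
  "right_congruence M \<rho> \<longleftrightarrow>
     equiv (carrier M) \<rho> \<and>
     (\<forall>(x, y) \<in> \<rho>. \<forall>s \<in> carrier M. (x \<otimes>\<^bsub>M\<^esub> s, y \<otimes>\<^bsub>M\<^esub> s) \<in> \<rho>)"

definition left_congruence :: "('m, 'b) monoid_scheme \<Rightarrow> ('m \<times> 'm) set \<Rightarrow> bool" where
  "left_congruence M \<rho> \<longleftrightarrow>
     equiv (carrier M) \<rho> \<and>
     (\<forall>(x, y) \<in> \<rho>. \<forall>s \<in> carrier M. (s \<otimes>\<^bsub>M\<^esub> x, s \<otimes>\<^bsub>M\<^esub> y) \<in> \<rho>)"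

definition two_sided_congruence :: "('m, 'b) monoid_scheme \<Rightarrow> ('m \<times> 'm) set \<Rightarrow> bool" where
  "two_sided_congruence M \<rho> \<longleftrightarrow> left_congruence M \<rho> \<and> right_congruence M \<rho>"


section \<open>Monoid presentations\<close>

definition free_monoid :: "'a set \<Rightarrow> 'a list monoid" where
  "free_monoid A = \<lparr>carrier = lists A, mult = (@), one = []\<rparr>"

text \<open>For \<open>R \<subseteq> lists A \<times> lists A\<close> the family intersected here contains the universal
  congruence \<open>lists A \<times> lists A\<close>, so the intersection is the least 2-sided congruence
  containing \<open>R\<close>.\<close>

definition generated_congruence :: "'a set \<Rightarrow> ('a list \<times> 'a list) set \<Rightarrow> ('a list \<times> 'a list) set" where
  "generated_congruence A R = \<Inter> {\<sigma>. two_sided_congruence (free_monoid A) \<sigma> \<and> R \<subseteq> \<sigma>}"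

text \<open>\<open>M\<close> is the monoid defined by \<open>\<langle>A | R\<rangle>\<close>, up to isomorphism, and \<open>\<theta>\<close> is the
  natural surjective homomorphism from the free monoid, whose kernel is the congruence generated
  by \<open>R\<close>. Only the values of \<open>\<theta>\<close> on \<open>lists A\<close> matter.\<close>

definition defined_by_presentation ::
  "'a set \<Rightarrow> ('a list \<times> 'a list) set \<Rightarrow> ('m, 'b) monoid_scheme \<Rightarrow> ('a list \<Rightarrow> 'm) \<Rightarrow> bool" where
  "defined_by_presentation A R M \<theta> \<longleftrightarrow>
     monoid M \<and>
     \<theta> \<in> hom (free_monoid A) M \<and> \<theta> [] = \<one>\<^bsub>M\<^esub> \<and>
     \<theta> ` lists A = carrier M \<and>
     {(u, v) \<in> lists A \<times> lists A. \<theta> u = \<theta> v} = generated_congruence A R"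


section \<open>Word graphs\<close>

definition word_graph :: "'a set \<Rightarrow> 'v set \<Rightarrow> ('v \<times> 'a \<times> 'v) set \<Rightarrow> bool" where
  "word_graph A V E \<longleftrightarrow> E \<subseteq> V \<times> A \<times> V"

definition complete_word_graph :: "'a set \<Rightarrow> 'v set \<Rightarrow> ('v \<times> 'a \<times> 'v) set \<Rightarrow> bool" where
  "complete_word_graph A V E \<longleftrightarrow>
     word_graph A V E \<and> (\<forall>\<alpha> \<in> V. \<forall>a \<in> A. \<exists>\<beta>. (\<alpha>, a, \<beta>) \<in> E)"

definition deterministic_word_graph :: "'a set \<Rightarrow> 'v set \<Rightarrow> ('v \<times> 'a \<times> 'v) set \<Rightarrow> bool" where
  "deterministic_word_graph A V E \<longleftrightarrow>
     word_graph A V E \<and>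
     (\<forall>\<alpha> \<in> V. \<forall>a \<in> A. \<forall>\<beta> \<gamma>. (\<alpha>, a, \<beta>) \<in> E \<longrightarrow> (\<alpha>, a, \<gamma>) \<in> E \<longrightarrow> \<beta> = \<gamma>)"

text \<open>\<open>labels_path V E \<alpha> u \<beta>\<close> is the relation \<open>\<alpha> \<cdot> u = \<beta>\<close>: the word \<open>u\<close> labels an
  \<open>(\<alpha>, \<beta>)\<close>-path. In a deterministic word graph \<open>\<beta>\<close> is determined by \<open>\<alpha>\<close> and
  \<open>u\<close>.\<close>

inductive labels_path :: "'v set \<Rightarrow> ('v \<times> 'a \<times> 'v) set \<Rightarrow> 'v \<Rightarrow> 'a list \<Rightarrow> 'v \<Rightarrow> bool"
  for V :: "'v set" and E :: "('v \<times> 'a \<times> 'v) set"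
where
  empty_path: "\<alpha> \<in> V \<Longrightarrow> labels_path V E \<alpha> [] \<alpha>"
| edge_path: "(\<alpha>, a, \<beta>) \<in> E \<Longrightarrow> labels_path V E \<beta> u \<gamma> \<Longrightarrow> labels_path V E \<alpha> (a # u) \<gamma>"

definition path_relation ::
  "'a set \<Rightarrow> 'v set \<Rightarrow> ('v \<times> 'a \<times> 'v) set \<Rightarrow> 'v \<Rightarrow> ('a list \<times> 'a list) set" where
  "path_relation A V E \<alpha> =
     {(u, v) \<in> lists A \<times> lists A. \<exists>\<beta>. labels_path V E \<alpha> u \<beta> \<and> labels_path V E \<alpha> v \<beta>}"

definition compatible ::
  "'v set \<Rightarrow> ('v \<times> 'a \<times> 'v) set \<Rightarrow> ('a list \<times> 'a list) set \<Rightarrow> bool" where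
  "compatible V E T \<longleftrightarrow>
     (\<forall>(u, v) \<in> T. \<forall>\<alpha> \<in> V. \<forall>\<beta> \<gamma>.
        labels_path V E \<alpha> u \<beta> \<longrightarrow> labels_path V E \<alpha> v \<gamma> \<longrightarrow> \<beta> = \<gamma>)"


section \<open>The short-lex order and standard word graphs\<close>

definition shortlex_less :: "'a::linorder list \<Rightarrow> 'a list \<Rightarrow> bool" where
  "shortlex_less u v \<longleftrightarrow> (u, v) \<in> lenlex {(a, b). a < b}"

text \<open>The short-lex least word labelling a \<open>(0, \<alpha>)\<close>-path; meaningful only when \<open>\<alpha>\<close> is
  reachable from \<open>0\<close> (and the alphabet is finite).\<close>

definition least_word :: "nat set \<Rightarrow> (nat \<times> 'a::linorder \<times> nat) set \<Rightarrow> nat \<Rightarrow> 'a list" where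
  "least_word V E \<alpha> =
     (THE w. labels_path V E 0 w \<alpha> \<and>
        (\<forall>u. labels_path V E 0 u \<alpha> \<longrightarrow> u = w \<or> shortlex_less w u))"

definition standard_word_graph ::
  "'a::linorder set \<Rightarrow> nat set \<Rightarrow> (nat \<times> 'a \<times> nat) set \<Rightarrow> bool" where
  "standard_word_graph A V E \<longleftrightarrow>
     complete_word_graph A V E \<and>
     V = (if finite V then {..<card V} else UNIV) \<and>
     deterministic_word_graph A V E \<and>
     (\<forall>\<alpha> \<in> V. \<exists>u. labels_path V E 0 u \<alpha>) \<and>
     (\<forall>\<alpha> \<in> V. \<forall>\<beta> \<in> V.
        \<alpha> < \<beta> \<longleftrightarrow> shortlex_less (least_word V E \<alpha>) (least_word V E \<beta>))"

text \<open>\<open>(V, E)\<close> is the word graph of the right congruence \<open>\<rho>\<close> on the monoid defined by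
  \<open>\<langle>A | R\<rangle>\<close> with natural homomorphism \<open>\<theta>\<close>. These conditions determine \<open>(V, E)\<close>
  uniquely, so \<open>the\<close> word graph of \<open>\<rho>\<close> is expressed by a predicate.\<close>

definition word_graph_of_right_congruence ::
  "'a::linorder set \<Rightarrow> ('a list \<times> 'a list) set \<Rightarrow> ('a list \<Rightarrow> 'm) \<Rightarrow> ('m \<times> 'm) set \<Rightarrow>
   nat set \<Rightarrow> (nat \<times> 'a \<times> nat) set \<Rightarrow> bool" where
  "word_graph_of_right_congruence A R \<theta> \<rho> V E \<longleftrightarrow>
     standard_word_graph A V E \<and>
     compatible V E R \<and>
     \<rho> = map_prod \<theta> \<theta> ` path_relation A V E 0"

end

theory Submission
  imports Defs
begin

text \<open>In a complete deterministic word graph every word acts as a total function on the nodes, so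
  \<open>A\<^sup>*\<close> acts on \<open>V\<close> from the right. Two congruences arise: the stabiliser relation
  \<open>0 \<cdot> u = 0 \<cdot> v\<close>, which is only a right congruence and is the preimage of \<open>\<rho>\<close> under
  \<open>\<theta>\<close>, and the kernel of the action, \<open>\<gamma> \<cdot> u = \<gamma> \<cdot> v\<close> for all \<open>\<gamma>\<close>, which is
  2-sided. Compatibility with a set of pairs of words says that these pairs lie in the kernel.

  Every node \<open>\<gamma>\<close> is \<open>0 \<cdot> w\<close> for some word \<open>w\<close>, so closing the stabiliser relation under left
  multiplication by \<open>w\<close> compares actions at \<open>\<gamma>\<close>. Hence \<open>\<rho>\<close> is 2-sided if and only if the
  stabiliser relation is contained in the kernel (lemma \<open>two_sided_iff_stabiliser_in_kernel\<close>).

  The pairs \<open>(w\<^sub>\<alpha> a, w\<^sub>\<beta>)\<close>, for edges \<open>(\<alpha>, a, \<beta>)\<close>, lie in the stabiliser relation and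
  generate it as a right congruence: starting from the empty word, which is the short-lex least
  word of the node \<open>0\<close>, and reading \<open>u\<close> letter by letter, they rewrite \<open>u\<close> to the
  representative of \<open>0 \<cdot> u\<close>. If they lie in the kernel then \<open>u\<close> acts everywhere as that
  representative, so words with the same value at \<open>0\<close> have the same action
  (lemma \<open>stabiliser_in_kernel_iff\<close>).\<close>

section \<open>The action of words on the nodes\<close>

locale total_word_graph =
  fixes A :: "'a set" and V :: "'v set" and E :: "('v \<times> 'a \<times> 'v) set"
  assumes complete: "complete_word_graph A V E"
    and deterministic: "deterministic_word_graph A V E"
begin

primrec act :: "'v \<Rightarrow> 'a list \<Rightarrow> 'v" where
  "act \<alpha> [] = \<alpha>"
| "act \<alpha> (a # u) = act (THE \<beta>. (\<alpha>, a, \<beta>) \<in> E) u"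

lemma edge_iff:
  assumes "\<alpha> \<in> V" "a \<in> A"
  shows "(\<alpha>, a, \<beta>) \<in> E \<longleftrightarrow> act \<alpha> [a] = \<beta>"
proof -
  have "\<exists>!\<beta>. (\<alpha>, a, \<beta>) \<in> E"
    using assms complete deterministic
    unfolding complete_word_graph_def deterministic_word_graph_def by blast
  then show ?thesis
    by (auto intro: theI' the1_equality)
qed

lemma edge_in: "(\<alpha>, a, \<beta>) \<in> E \<Longrightarrow> \<alpha> \<in> V \<and> a \<in> A \<and> \<beta> \<in> V"
  using complete unfolding complete_word_graph_def word_graph_def by blast

lemma edge_act: "\<alpha> \<in> V \<Longrightarrow> a \<in> A \<Longrightarrow> (\<alpha>, a, act \<alpha> [a]) \<in> E"
  by (simp only: edge_iff)

lemma act_append: "act \<alpha> (u @ v) = act (act \<alpha> u) v"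
  by (induction u arbitrary: \<alpha>) auto

lemma act_Cons: "act \<alpha> (a # u) = act (act \<alpha> [a]) u"
  by simp

lemma act_in: "\<alpha> \<in> V \<Longrightarrow> u \<in> lists A \<Longrightarrow> act \<alpha> u \<in> V"
proof (induction u arbitrary: \<alpha>)
  case (Cons a u)
  then have "a \<in> A" "u \<in> lists A"
    by auto
  then have "act \<alpha> [a] \<in> V"
    using Cons.prems edge_act edge_in by blast
  then show ?case
    unfolding act_Cons[of \<alpha> a u] using Cons.IH \<open>u \<in> lists A\<close> by blast
qed simp

lemma labels_path_iff:
  "labels_path V E \<alpha> u \<beta> \<longleftrightarrow> \<alpha> \<in> V \<and> u \<in> lists A \<and> act \<alpha> u = \<beta>"
proof
  show "labels_path V E \<alpha> u \<beta> \<Longrightarrow> \<alpha> \<in> V \<and> u \<in> lists A \<and> act \<alpha> u = \<beta>"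
  proof (induction rule: labels_path.induct)
    case (edge_path \<alpha> a \<beta> u \<gamma>)
    then have "\<alpha> \<in> V" "a \<in> A" "act \<alpha> [a] = \<beta>"
      using edge_in[of \<alpha> a \<beta>] edge_iff[of \<alpha> a \<beta>] by blast+
    then show ?case
      using edge_path.IH unfolding act_Cons[of \<alpha> a u] by (simp del: act.simps)
  qed simp
next
  show "\<alpha> \<in> V \<and> u \<in> lists A \<and> act \<alpha> u = \<beta> \<Longrightarrow> labels_path V E \<alpha> u \<beta>"
  proof (induction u arbitrary: \<alpha>)
    case (Cons a u)
    then have step: "(\<alpha>, a, act \<alpha> [a]) \<in> E"
      by (intro edge_act) auto
    moreover have "labels_path V E (act \<alpha> [a]) u \<beta>"
      using Cons.prems edge_in[OF step] unfolding act_Cons[of \<alpha> a u]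
      by (intro Cons.IH) (simp del: act.simps)
    ultimately show ?case
      by (rule labels_path.edge_path)
  qed (simp add: labels_path.empty_path)
qed

definition action_kernel :: "('a list \<times> 'a list) set" where
  "action_kernel = {(u, v) \<in> lists A \<times> lists A. \<forall>\<alpha>\<in>V. act \<alpha> u = act \<alpha> v}"

lemma compatible_iff_subset_kernel:
  assumes "T \<subseteq> lists A \<times> lists A"
  shows "compatible V E T \<longleftrightarrow> T \<subseteq> action_kernel"
  using assms unfolding compatible_def action_kernel_def labels_path_iff by blast

lemma path_relation_eq:
  assumes "\<alpha> \<in> V"
  shows "path_relation A V E \<alpha> = {(u, v) \<in> lists A \<times> lists A. act \<alpha> u = act \<alpha> v}"
  using assms unfolding path_relation_def labels_path_iff by auto

lemma two_sided_congruence_kernel: "two_sided_congruence (free_monoid A) action_kernel"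
proof -
  have "equiv (lists A) action_kernel"
    by (auto simp: action_kernel_def equiv_def refl_on_def sym_def trans_def)
  then show ?thesis
    by (auto simp: two_sided_congruence_def left_congruence_def right_congruence_def
        free_monoid_def action_kernel_def act_append act_in)
qed

lemma generated_congruence_subset_kernel:
  assumes "R \<subseteq> lists A \<times> lists A" "compatible V E R"
  shows "generated_congruence A R \<subseteq> action_kernel"
  using assms two_sided_congruence_kernel compatible_iff_subset_kernel
  unfolding generated_congruence_def by blast

section \<open>The stabiliser relation and the kernel of the action\<close>

text \<open>Compatibility with \<open>R\<close> makes \<open>\<theta> u = \<theta> u'\<close> imply that \<open>u\<close> and \<open>u'\<close> act alike, so
  the path relation at a node is saturated for \<open>\<theta>\<close> and can be recovered from its image.\<close>

lemma image_path_relation_iff: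
  assumes R: "R \<subseteq> lists A \<times> lists A" "compatible V E R"
    and pres: "defined_by_presentation A R M \<theta>"
    and V: "\<alpha> \<in> V" and uv: "u \<in> lists A" "v \<in> lists A"
  shows "(\<theta> u, \<theta> v) \<in> map_prod \<theta> \<theta> ` path_relation A V E \<alpha> \<longleftrightarrow> act \<alpha> u = act \<alpha> v"
proof
  have saturated: "act \<alpha> x = act \<alpha> y" if "x \<in> lists A" "y \<in> lists A" "\<theta> x = \<theta> y" for x y
  proof -
    have "(x, y) \<in> generated_congruence A R"
      using that pres unfolding defined_by_presentation_def by blast
    then show ?thesis
      using generated_congruence_subset_kernel[OF R] V unfolding action_kernel_def by blast
  qed
  assume "(\<theta> u, \<theta> v) \<in> map_prod \<theta> \<theta> ` path_relation A V E \<alpha>"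
  then obtain x y where "x \<in> lists A" "y \<in> lists A" "act \<alpha> x = act \<alpha> y" "\<theta> u = \<theta> x" "\<theta> v = \<theta> y"
    using path_relation_eq[OF V] by auto
  then show "act \<alpha> u = act \<alpha> v"
    using saturated uv by metis
next
  assume "act \<alpha> u = act \<alpha> v"
  then have "(u, v) \<in> path_relation A V E \<alpha>"
    using path_relation_eq[OF V] uv by simp
  then show "(\<theta> u, \<theta> v) \<in> map_prod \<theta> \<theta> ` path_relation A V E \<alpha>"
    by force
qed

text \<open>Left multiplication by \<open>w\<close> moves the base point from \<open>r\<close> to \<open>r \<cdot> w\<close>, and by
  reachability these are all the nodes. So closing the relation at \<open>r\<close> under left
  multiplication means agreement at every node.\<close>

lemma two_sided_iff_stabiliser_in_kernel:
  assumes R: "R \<subseteq> lists A \<times> lists A" "compatible V E R"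
    and pres: "defined_by_presentation A R M \<theta>"
    and right: "right_congruence M \<rho>"
    and \<rho>: "\<rho> = map_prod \<theta> \<theta> ` path_relation A V E r"
    and root: "r \<in> V" "\<forall>\<alpha>\<in>V. \<exists>w\<in>lists A. act r w = \<alpha>"
  shows "two_sided_congruence M \<rho> \<longleftrightarrow> path_relation A V E r \<subseteq> action_kernel"
proof -
  have \<theta>_append: "\<theta> (w @ u) = \<theta> w \<otimes>\<^bsub>M\<^esub> \<theta> u" if "w \<in> lists A" "u \<in> lists A" for w u
    using pres that unfolding defined_by_presentation_def hom_def free_monoid_def by simp
  have surj: "\<theta> ` lists A = carrier M"
    using pres unfolding defined_by_presentation_def by blast
  have \<rho>_iff: "(\<theta> u, \<theta> v) \<in> \<rho> \<longleftrightarrow> act r u = act r v" if "u \<in> lists A" "v \<in> lists A" for u v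
    using image_path_relation_iff[OF R pres root(1) that] \<rho> by simp
  show ?thesis
  proof
    assume two: "two_sided_congruence M \<rho>"
    show "path_relation A V E r \<subseteq> action_kernel"
    proof clarify
      fix u v assume "(u, v) \<in> path_relation A V E r"
      then have uv: "u \<in> lists A" "v \<in> lists A" "(\<theta> u, \<theta> v) \<in> \<rho>"
        using path_relation_eq[OF root(1)] \<rho>_iff by auto
      have "act \<alpha> u = act \<alpha> v" if \<alpha>: "\<alpha> \<in> V" for \<alpha>
      proof -
        obtain w where w: "w \<in> lists A" "act r w = \<alpha>"
          using root(2) \<alpha> by blast
        have "(\<theta> w \<otimes>\<^bsub>M\<^esub> \<theta> u, \<theta> w \<otimes>\<^bsub>M\<^esub> \<theta> v) \<in> \<rho>"
          using two uv(3) w(1) surj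
          unfolding two_sided_congruence_def left_congruence_def by blast
        then have "(\<theta> (w @ u), \<theta> (w @ v)) \<in> \<rho>"
          using \<theta>_append uv w by simp
        then show ?thesis
          using \<rho>_iff[of "w @ u" "w @ v"] uv w by (simp add: act_append)
      qed
      then show "(u, v) \<in> action_kernel"
        using uv unfolding action_kernel_def by blast
    qed
  next
    assume sub: "path_relation A V E r \<subseteq> action_kernel"
    have "(s \<otimes>\<^bsub>M\<^esub> x, s \<otimes>\<^bsub>M\<^esub> y) \<in> \<rho>" if xy: "(x, y) \<in> \<rho>" and s: "s \<in> carrier M" for x y s
    proof -
      obtain u v where uv: "(u, v) \<in> path_relation A V E r" "x = \<theta> u" "y = \<theta> v"
        using xy \<rho> by auto
      obtain w where w: "w \<in> lists A" "s = \<theta> w"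
        using s surj by blast
      have "u \<in> lists A" "v \<in> lists A" "act (act r w) u = act (act r w) v"
        using uv(1) sub act_in[OF root(1) w(1)] unfolding action_kernel_def by blast+
      then show ?thesis
        using \<rho>_iff[of "w @ u" "w @ v"] w uv by (simp add: act_append \<theta>_append)
    qed
    then show "two_sided_congruence M \<rho>"
      using right
      unfolding two_sided_congruence_def left_congruence_def right_congruence_def by blast
  qed
qed

text \<open>If the pairs lie in the kernel, induction on \<open>u\<close> shows that \<open>u\<close> acts at every node
  as \<open>rep (r \<cdot> u)\<close>: a prefix already acts as the representative of its end point, and the
  pair of the next edge absorbs the next letter. The induction starts because
  \<open>rep r = []\<close> acts trivially. So the action of \<open>u\<close> depends on \<open>r \<cdot> u\<close> alone.\<close>

lemma stabiliser_in_kernel_iff: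
  assumes root: "r \<in> V"
    and rep: "\<And>\<alpha>. \<alpha> \<in> V \<Longrightarrow> rep \<alpha> \<in> lists A \<and> act r (rep \<alpha>) = \<alpha>"
    and rep_root: "rep r = []"
  shows "path_relation A V E r \<subseteq> action_kernel \<longleftrightarrow>
    compatible V E {(rep \<alpha> @ [a], rep \<beta>) |\<alpha> a \<beta>. (\<alpha>, a, \<beta>) \<in> E}" (is "_ \<longleftrightarrow> compatible V E ?T")
proof -
  have T: "?T \<subseteq> path_relation A V E r"
  proof clarify
    fix \<alpha> a \<beta> assume e: "(\<alpha>, a, \<beta>) \<in> E"
    then have "act r (rep \<alpha> @ [a]) = act r (rep \<beta>)"
      using edge_in edge_iff rep unfolding act_append by metis
    then show "(rep \<alpha> @ [a], rep \<beta>) \<in> path_relation A V E r"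
      using rep edge_in[OF e] by (simp add: path_relation_eq[OF root])
  qed
  then have compat: "compatible V E ?T \<longleftrightarrow> ?T \<subseteq> action_kernel"
    by (intro compatible_iff_subset_kernel) (use path_relation_eq[OF root] in blast)
  have "path_relation A V E r \<subseteq> action_kernel" if sub: "?T \<subseteq> action_kernel"
  proof -
    have normal: "act \<gamma> u = act \<gamma> (rep (act r u))" if "\<gamma> \<in> V" "u \<in> lists A" for \<gamma> u
      using that(2)
    proof (induction u rule: rev_induct)
      case Nil
      then show ?case
        by (simp add: rep_root)
    next
      case (snoc a u)
      let ?\<alpha> = "act r u" and ?\<beta> = "act r (u @ [a])"
      have "(?\<alpha>, a, ?\<beta>) \<in> E"
        using snoc.prems act_in[OF root] by (simp add: edge_iff act_append del: act.simps)
      then have "(rep ?\<alpha> @ [a], rep ?\<beta>) \<in> action_kernel"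
        using sub by blast
      then have "act \<gamma> (rep ?\<alpha> @ [a]) = act \<gamma> (rep ?\<beta>)"
        using that(1) unfolding action_kernel_def by blast
      then show ?case
        using snoc by (simp add: act_append del: act.simps)
    qed
    show ?thesis
    proof clarify
      fix u v assume "(u, v) \<in> path_relation A V E r"
      then have uv: "u \<in> lists A" "v \<in> lists A" "act r u = act r v"
        using path_relation_eq[OF root] by auto
      then have "act \<gamma> u = act \<gamma> v" if "\<gamma> \<in> V" for \<gamma>
        using normal[OF that uv(1)] normal[OF that uv(2)] by simp
      then show "(u, v) \<in> action_kernel"
        using uv unfolding action_kernel_def by blast
    qed
  qed
  then show ?thesis
    using T compat by blast
qed

end

section \<open>Short-lex least words\<close>

text \<open>Over a finite alphabet the words no longer than a given one form a finite set, so the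
  short-lex order, although it may fail to be a well-order on all lists over the ambient
  type, has a least element in every nonempty set of words over \<open>A\<close>.\<close>

lemma shortlex_least_exists:
  fixes A :: "'a::linorder set"
  assumes "finite A" "S \<subseteq> lists A" "S \<noteq> {}"
  shows "\<exists>!w. w \<in> S \<and> (\<forall>u\<in>S. u = w \<or> shortlex_less w u)"
proof -
  have irrefl: "\<not> shortlex_less u u" for u :: "'a list"
    unfolding shortlex_less_def by (simp add: lenlex_irreflexive)
  have trans: "shortlex_less u w" if "shortlex_less u v" "shortlex_less v w" for u v w :: "'a list"
    using that lenlex_transI[of "{(a, b). a < (b::'a)}"]
    unfolding shortlex_less_def trans_def by force
  have total: "u = v \<or> shortlex_less u v \<or> shortlex_less v u" for u v :: "'a list"
    using total_lenlex[of "{(a, b). a < (b::'a)}"]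
    unfolding shortlex_less_def total_on_def by force
  obtain s where s: "s \<in> S"
    using assms(3) by blast
  let ?B = "{u \<in> S. length u \<le> length s}"
  have "finite ?B"
    by (rule finite_subset[OF _ finite_lists_length_le[OF assms(1), of "length s"]])
      (use assms(2) in auto)
  then obtain w where w: "w \<in> ?B" "\<forall>u\<in>?B. u \<noteq> w \<longrightarrow> shortlex_less w u"
    using Finite_Set.bex_least_element[of ?B shortlex_less] s transpI[of shortlex_less] trans total
    unfolding totalp_on_def transp_on_def by blast
  have "u = w \<or> shortlex_less w u" if "u \<in> S" for u
  proof (cases "length u \<le> length s")
    case True
    then show ?thesis
      using w that by blast
  next
    case False
    then show ?thesis
      using w(1) by (simp add: shortlex_less_def lenlex_conv)
  qed
  moreover have "w \<in> S"
    using w(1) by blast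
  ultimately show ?thesis
    using irrefl trans by metis
qed

lemma least_word_properties:
  fixes A :: "'a::linorder set"
  assumes "finite A" "total_word_graph A V E" "labels_path V E 0 u \<alpha>"
  shows "labels_path V E 0 (least_word V E \<alpha>) \<alpha>"
    and "\<And>u. labels_path V E 0 u \<alpha> \<Longrightarrow> u = least_word V E \<alpha> \<or> shortlex_less (least_word V E \<alpha>) u"
proof -
  have "\<exists>!w. w \<in> {u. labels_path V E 0 u \<alpha>} \<and>
      (\<forall>u\<in>{u. labels_path V E 0 u \<alpha>}. u = w \<or> shortlex_less w u)"
    by (rule shortlex_least_exists[OF assms(1)])
      (use assms(3) total_word_graph.labels_path_iff[OF assms(2)] in blast)+
  then have "\<exists>!w. labels_path V E 0 w \<alpha> \<and>
      (\<forall>u. labels_path V E 0 u \<alpha> \<longrightarrow> u = w \<or> shortlex_less w u)"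
    by simp
  from theI'[OF this]
  show "labels_path V E 0 (least_word V E \<alpha>) \<alpha>"
    and "\<And>u. labels_path V E 0 u \<alpha> \<Longrightarrow> u = least_word V E \<alpha> \<or> shortlex_less (least_word V E \<alpha>) u"
    unfolding least_word_def by blast+
qed

lemma least_word_root:
  fixes A :: "'a::linorder set"
  assumes "finite A" "total_word_graph A V E" "0 \<in> V"
  shows "least_word V E 0 = []"
  using least_word_properties(2)[OF assms(1,2), of "[]" 0 "[]"] labels_path.empty_path[OF assms(3), of E]
  by (simp add: shortlex_less_def)

section \<open>Two-sided congruences\<close>

theorem theorem5p3:
  fixes A :: "'a::linorder set"
    and R :: "('a list \<times> 'a list) set"
    and M :: "('m, 'b) monoid_scheme"
    and \<theta> :: "'a list \<Rightarrow> 'm"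
    and \<rho> :: "('m \<times> 'm) set"
    and V :: "nat set"
    and E :: "(nat \<times> 'a \<times> nat) set"
  assumes "finite A"
    and "R \<subseteq> lists A \<times> lists A"
    and "defined_by_presentation A R M \<theta>"
    and "right_congruence M \<rho>"
    and "word_graph_of_right_congruence A R \<theta> \<rho> V E"
  shows "two_sided_congruence M \<rho> \<longleftrightarrow>
    compatible V E {(least_word V E \<alpha> @ [a], least_word V E \<beta>) |\<alpha> a \<beta>. (\<alpha>, a, \<beta>) \<in> E}"
proof -
  have std: "standard_word_graph A V E" and compat: "compatible V E R"
    and \<rho>: "\<rho> = map_prod \<theta> \<theta> ` path_relation A V E 0"
    using assms(5) unfolding word_graph_of_right_congruence_def by blast+
  have reach: "\<forall>\<alpha>\<in>V. \<exists>u. labels_path V E 0 u \<alpha>"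
    using std unfolding standard_word_graph_def by blast
  interpret total_word_graph A V E
    using std unfolding standard_word_graph_def by unfold_locales blast+
  \<comment> \<open>The empty graph satisfies the conditions of a standard graph, but its path relation is
    empty, whereas \<open>\<rho>\<close> relates the identity of \<open>M\<close> to itself.\<close>
  have root: "0 \<in> V"
  proof -
    have "(\<one>\<^bsub>M\<^esub>, \<one>\<^bsub>M\<^esub>) \<in> \<rho>"
      using assms(3,4) monoid.one_closed
      unfolding defined_by_presentation_def right_congruence_def equiv_def refl_on_def by blast
    then show ?thesis
      unfolding \<rho> path_relation_def labels_path_iff by auto
  qed
  have rep: "least_word V E \<alpha> \<in> lists A \<and> act 0 (least_word V E \<alpha>) = \<alpha>" if "\<alpha> \<in> V" for \<alpha>
    using reach that least_word_properties(1)[OF assms(1) total_word_graph_axioms]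
    unfolding labels_path_iff by blast
  have "two_sided_congruence M \<rho> \<longleftrightarrow> path_relation A V E 0 \<subseteq> action_kernel"
    using two_sided_iff_stabiliser_in_kernel[OF assms(2) compat assms(3,4) \<rho> root] rep by blast
  also have "\<dots> \<longleftrightarrow>
      compatible V E {(least_word V E \<alpha> @ [a], least_word V E \<beta>) |\<alpha> a \<beta>. (\<alpha>, a, \<beta>) \<in> E}"
    by (rule stabiliser_in_kernel_iff[OF root rep least_word_root[OF assms(1) _ root]])
      (simp_all add: total_word_graph_axioms)
  finally show ?thesis .
qed

end
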